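(* We have $$\sum_{n\geq1}c_n(2\text{-}21)t^n=\frac{t}{1-2t}-\sum_{i\geq1}\frac{(-1)^i\,t^{\frac{i(i+5)}{2}}(1-2t)\sum_{j=1}^i\frac{(1-t)^j}{(1-2t)(1-t)^j-(1-t)^2t^j}}{\prod_{j=1}^i\left((1-2t)(1-t)^j-(1-t)^2t^j\right)}.$$
   Context: A Catalan word of length $n\ge 1$ is a sequence $\pi=\pi_1\cdots\pi_n$ of positive integers with $\pi_1=1$ and $\pi_{i+1}\le \pi_i+1$ for $1\le i\le n-1$; $\mathcal{C}_n$ is the set of these. Two sequences of the same length are order-isomorphic if their corresponding pairs of entries stand in the same relation ($<$, $>$ or $=$). A word $\pi$ contains the vincular pattern $x\text{-}yz$ if there are indices $i<j$ with $j+1\le n$ such that $\pi_i\pi_j\pi_{j+1}$ is order-isomorphic to $xyz$ (the last two letters must be adjacent in $\pi$); otherwise $\pi$ avoids it. $c_n(\tau)$ denotes the number of members of $\mathcal{C}_n$ avoiding $\tau$. The identity is one of power series in $t$ (rational expressions expanded about $t=0$). *)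

theory Defs
  imports Complex_Main "HOL-Computational_Algebra.Formal_Power_Series"
begin

text \<open>Words are lists, so the letter written $\pi_i$ on paper is \<open>w ! (i - 1)\<close>.\<close>

definition catalan_words :: "nat \<Rightarrow> nat list set" where
  "catalan_words n = {w. length w = n \<and> n \<ge> 1 \<and> (\<forall>x\<in>set w. x \<ge> 1) \<and> w ! 0 = 1 \<and>
     (\<forall>i. Suc i < n \<longrightarrow> w ! Suc i \<le> w ! i + 1)}"

definition order_isomorphic :: "nat list \<Rightarrow> nat list \<Rightarrow> bool" where
  "order_isomorphic u v \<longleftrightarrow> length u = length v \<and>
     (\<forall>i<length u. \<forall>j<length u.
        (u ! i < u ! j \<longleftrightarrow> v ! i < v ! j) \<and>
        (u ! i > u ! j \<longleftrightarrow> v ! i > v ! j) \<and>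
        (u ! i = u ! j \<longleftrightarrow> v ! i = v ! j))"

text \<open>The triple \<open>(x, y, z)\<close> stands for the vincular pattern $x$-$yz$: only the last two
  letters of an occurrence have to be adjacent.\<close>

fun contains_vincular :: "nat list \<Rightarrow> nat \<times> nat \<times> nat \<Rightarrow> bool" where
  "contains_vincular w (x, y, z) \<longleftrightarrow>
     (\<exists>i j. i < j \<and> Suc j < length w \<and> order_isomorphic [w ! i, w ! j, w ! Suc j] [x, y, z])"

definition catalan_avoid_count :: "nat \<times> nat \<times> nat \<Rightarrow> nat \<Rightarrow> nat" where
  "catalan_avoid_count p n = card {w \<in> catalan_words n. \<not> contains_vincular w p}"

text \<open>For $j \ge 1$ the following series has constant coefficient 1, so that dividing by it is
  multiplication by its inverse power series.\<close>

definition gf_denom :: "nat \<Rightarrow> rat fps" where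
  "gf_denom j = (1 - 2 * fps_X) * (1 - fps_X) ^ j - (1 - fps_X)\<^sup>2 * fps_X ^ j"

definition gf_summand :: "nat \<Rightarrow> rat fps" where
  "gf_summand i =
     ((-1) ^ i * fps_X ^ (i * (i + 5) div 2) * (1 - 2 * fps_X) *
        (\<Sum>j=1..i. (1 - fps_X) ^ j / gf_denom j)) /
     (\<Prod>j=1..i. gf_denom j)"

end

theory Submission
  imports Defs
begin

text \<open>
  A word avoids 2-21 iff every descent top is the first occurrence of its letter. In a Catalan
  word the first occurrence of a letter is a new maximum, so a word with maximum \<open>m\<close> that is
  read from left to right is in one of two situations. If its last letter is fresh, then it
  equals \<open>m\<close>, and any of the letters \<open>1, \<dots>, m + 1\<close> may follow. If its last letter \<open>l\<close> is
  stale, then only \<open>l\<close> or \<open>l + 1\<close> may follow. The number of extensions hence depends on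
  \<open>m\<close>, \<open>l\<close> and the freshness only (\<open>card_extensions\<close>).

  Put $q = t/(1-t)$ and $x = t(1-t)/(1-2t)$. The series $1/(1-2t)$ counts the extensions if each
  step has exactly two choices; it solves the stale equations, and subtracting it makes them
  homogeneous. Eliminating them leaves, for the series $E_m$ of extensions of a word with fresh
  maximum $m$,
  \[ E_m - \frac{1}{1-2t} = \frac{(m-1)t}{1-2t} + x(1-q^{m+1})
     \Bigl(E_{m+1} - \frac{1}{1-2t}\Bigr), \]
  see \<open>gf_fresh_shift\<close>. Iterating this from $m = 1$ and multiplying by $t$ gives the wanted
  series as $\frac{t}{1-2t} + \frac{t^2}{1-2t} D(x)$ with $D(z) = \sum_m m z^m (q^2;q)_m$ (\<open>gf_fresh_1\<close>).

  It remains to turn $D$ into the alternating sum. Let $B(z) = \sum_m z^m (q^2;q)_m$ and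
  $c = q^2/(1-q^2) = t^2/(1-2t)$. Comparing each summand with the next one yields equations between
  the values of $B$ and $D$ at $z$ and at $zq$ (\<open>qsum_shift\<close>, \<open>qsum_weighted_shift\<close>). For
  $Q = 1 + c(1 - B)$ and $R = -cD$ they become
  \[ Q(z) = 1 + a\,Q(zq), \quad R(z) = a\Bigl(\frac{Q(zq)}{1-z} + R(zq)\Bigr), \quad
     a = \frac{-zq^2}{1-z}. \]
  Iterated at $z = x, xq, xq^2, \dots$, the first equation produces the products $\prod_s a(xq^s)$
  and the second one multiplies them by the sums of the $1/(1-xq^s)$ (\<open>alt_term_sums\<close>). Because
  the $j$-th denominator of the theorem is $(1-t)^j(1-2t)(1-xq^{j-1})$, these are precisely the
  summands of the theorem (\<open>gf_summand_eq\<close>).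
\<close>

section \<open>Infinite sums of formal power series\<close>

text \<open>In the topology of formal power series, convergence means that every coefficient is
  eventually constant. This criterion gives the arithmetic of infinite sums used below.\<close>

lemma fps_sums_iff:
  fixes f :: "nat \<Rightarrow> 'a :: comm_ring_1 fps"
  shows "f sums S \<longleftrightarrow> (\<forall>n. \<forall>\<^sub>F N in sequentially. (\<Sum>i<N. fps_nth (f i) n) = fps_nth S n)"
  unfolding sums_def tendsto_fps_iff by (simp add: fps_sum_nth)

lemma fps_sums_add:
  fixes f g :: "nat \<Rightarrow> 'a :: comm_ring_1 fps"
  assumes "f sums S" and "g sums T"
  shows "(\<lambda>i. f i + g i) sums (S + T)"
  unfolding fps_sums_iff
proof
  fix n
  from assms have "\<forall>\<^sub>F N in sequentially. (\<Sum>i<N. fps_nth (f i) n) = fps_nth S n"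
    and "\<forall>\<^sub>F N in sequentially. (\<Sum>i<N. fps_nth (g i) n) = fps_nth T n"
    by (auto simp: fps_sums_iff)
  then show "\<forall>\<^sub>F N in sequentially. (\<Sum>i<N. fps_nth (f i + g i) n) = fps_nth (S + T) n"
    by eventually_elim (simp add: sum.distrib)
qed

lemma fps_sums_mult:
  fixes f :: "nat \<Rightarrow> 'a :: comm_ring_1 fps"
  assumes "f sums S"
  shows "(\<lambda>i. c * f i) sums (c * S)"
  unfolding fps_sums_iff
proof
  fix n
  have "\<forall>\<^sub>F N in sequentially. \<forall>k\<in>{0..n}. (\<Sum>i<N. fps_nth (f i) k) = fps_nth S k"
    using assms by (intro eventually_ball_finite) (auto simp: fps_sums_iff)
  then show "\<forall>\<^sub>F N in sequentially. (\<Sum>i<N. fps_nth (c * f i) n) = fps_nth (c * S) n"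
  proof eventually_elim
    case (elim N)
    have "(\<Sum>i<N. fps_nth (c * f i) n) = (\<Sum>k=0..n. fps_nth c k * (\<Sum>i<N. fps_nth (f i) (n - k)))"
      unfolding fps_mult_nth by (subst sum.swap) (simp add: sum_distrib_left)
    also have "\<dots> = fps_nth (c * S) n"
      unfolding fps_mult_nth using elim by (intro sum.cong) auto
    finally show ?case .
  qed
qed

lemma fps_sums_from_Suc:
  fixes f :: "nat \<Rightarrow> 'a :: comm_ring_1 fps"
  assumes "(\<lambda>i. f (Suc i)) sums S"
  shows "f sums (f 0 + S)"
  unfolding fps_sums_iff
proof
  fix n
  from assms have "\<forall>\<^sub>F N in sequentially. (\<Sum>i<N. fps_nth (f (Suc i)) n) = fps_nth S n"
    by (auto simp: fps_sums_iff)
  then have "\<forall>\<^sub>F N in sequentially. (\<Sum>i<Suc N. fps_nth (f i) n) = fps_nth (f 0 + S) n"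
    by eventually_elim (simp only: sum.lessThan_Suc_shift fps_add_nth)
  then show "\<forall>\<^sub>F N in sequentially. (\<Sum>i<N. fps_nth (f i) n) = fps_nth (f 0 + S) n"
    by (subst (asm) eventually_sequentially_Suc)
qed

lemma fps_X_power_dvd_nth:
  fixes f :: "'a :: comm_ring_1 fps"
  assumes "fps_X ^ N dvd f" and "n < N"
  shows "fps_nth f n = 0"
  using assms by (auto elim!: dvdE simp: fps_X_power_mult_nth)

lemma fps_X_dvd_iff:
  fixes f :: "'a :: comm_ring_1 fps"
  shows "fps_X dvd f \<longleftrightarrow> fps_nth f 0 = 0"
proof
  assume "fps_nth f 0 = 0"
  then have "f = fps_X * fps_shift 1 f"
    by (auto simp: fps_eq_iff fps_X_mult_nth)
  then show "fps_X dvd f"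
    by (rule dvdI)
qed (auto elim!: dvdE)

lemma fps_sums_if_remainders_dvd:
  fixes f :: "nat \<Rightarrow> 'a :: comm_ring_1 fps"
  assumes "\<And>N. fps_X ^ N dvd S - (\<Sum>i<N. f i)"
  shows "f sums S"
  unfolding fps_sums_iff
proof
  fix n
  show "\<forall>\<^sub>F N in sequentially. (\<Sum>i<N. fps_nth (f i) n) = fps_nth S n"
    using eventually_gt_at_top[of n]
  proof eventually_elim
    case (elim N)
    from fps_X_power_dvd_nth[OF assms elim] show ?case
      by (simp add: fps_sum_nth)
  qed
qed

lemma fps_summable_if_terms_dvd:
  fixes f :: "nat \<Rightarrow> 'a :: comm_ring_1 fps"
  assumes "\<And>m. fps_X ^ m dvd f m"
  shows "summable f"
proof -
  have "f sums Abs_fps (\<lambda>n. \<Sum>m\<le>n. fps_nth (f m) n)"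
    unfolding fps_sums_iff
  proof
    fix n
    show "\<forall>\<^sub>F N in sequentially. (\<Sum>i<N. fps_nth (f i) n)
        = fps_nth (Abs_fps (\<lambda>n. \<Sum>m\<le>n. fps_nth (f m) n)) n"
      using eventually_gt_at_top[of n]
    proof eventually_elim
      case (elim N)
      have "(\<Sum>m\<le>n. fps_nth (f m) n) = (\<Sum>i<N. fps_nth (f i) n)"
        using elim by (intro sum.mono_neutral_left) (auto intro: fps_X_power_dvd_nth[OF assms])
      then show ?case by simp
    qed
  qed
  then show ?thesis by (rule sums_summable)
qed

section \<open>A transformation of q-series\<close>

text \<open>The $q$-Pochhammer symbol $(q^2;q)_m$.\<close>

definition qprod :: "rat fps \<Rightarrow> nat \<Rightarrow> rat fps" where
  "qprod q m = (\<Prod>k<m. 1 - q ^ (k + 2))"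

definition qsum :: "rat fps \<Rightarrow> rat fps \<Rightarrow> rat fps" where
  "qsum q z = (\<Sum>m. z ^ m * qprod q m)"

definition qsum_weighted :: "rat fps \<Rightarrow> rat fps \<Rightarrow> rat fps" where
  "qsum_weighted q z = (\<Sum>m. of_nat m * (z ^ m * qprod q m))"

lemma qsum_sums:
  assumes "fps_nth z 0 = 0"
  shows "(\<lambda>m. z ^ m * qprod q m) sums qsum q z"
  unfolding qsum_def using assms
  by (intro summable_sums fps_summable_if_terms_dvd dvd_mult2 dvd_power_same) (simp add: fps_X_dvd_iff)

lemma qsum_weighted_sums:
  assumes "fps_nth z 0 = 0"
  shows "(\<lambda>m. of_nat m * (z ^ m * qprod q m)) sums qsum_weighted q z"
  unfolding qsum_weighted_def using assms
  by (intro summable_sums fps_summable_if_terms_dvd dvd_mult dvd_mult2 dvd_power_same)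
     (simp add: fps_X_dvd_iff)

text \<open>The last factor $1 - q^{m+2}$ of \<open>qprod q (Suc m)\<close> is split up, and the power of $q$ is
  absorbed into $(zq)^m$. This is the source of both functional equations.\<close>

lemma qterm_Suc:
  "z ^ Suc m * qprod q (Suc m)
     = z * (z ^ m * qprod q m) + (- (z * q\<^sup>2)) * ((z * q) ^ m * qprod q m)"
  by (simp add: qprod_def power_mult_distrib algebra_simps power2_eq_square power_add)

lemma qsum_shift:
  assumes "fps_nth z 0 = 0"
  shows "(1 - z) * qsum q z = 1 - z * q\<^sup>2 * qsum q (z * q)"
proof -
  have "(\<lambda>m. z ^ Suc m * qprod q (Suc m)) sums
      (z * qsum q z + (- (z * q\<^sup>2)) * qsum q (z * q))"
    unfolding qterm_Suc using assms by (intro fps_sums_add fps_sums_mult qsum_sums) auto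
  then have "(\<lambda>m. z ^ m * qprod q m) sums
      (z ^ 0 * qprod q 0 + (z * qsum q z + (- (z * q\<^sup>2)) * qsum q (z * q)))"
    by (rule fps_sums_from_Suc[where f = "\<lambda>m. z ^ m * qprod q m"])
  from sums_unique2[OF this qsum_sums[OF assms]] show ?thesis
    by (simp add: qprod_def algebra_simps)
qed

lemma qsum_weighted_shift:
  assumes "fps_nth z 0 = 0"
  shows "qsum_weighted q z = z * (qsum_weighted q z + qsum q z)
           - z * q\<^sup>2 * (qsum_weighted q (z * q) + qsum q (z * q))"
proof -
  have split: "of_nat (Suc m) * (z ^ Suc m * qprod q (Suc m))
      = z * (of_nat m * (z ^ m * qprod q m) + z ^ m * qprod q m)
        + (- (z * q\<^sup>2)) * (of_nat m * ((z * q) ^ m * qprod q m) + (z * q) ^ m * qprod q m)" for m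
    unfolding qterm_Suc by (simp add: algebra_simps)
  have "(\<lambda>m. of_nat (Suc m) * (z ^ Suc m * qprod q (Suc m))) sums
      (z * (qsum_weighted q z + qsum q z)
        + (- (z * q\<^sup>2)) * (qsum_weighted q (z * q) + qsum q (z * q)))"
    unfolding split using assms
    by (intro fps_sums_add fps_sums_mult qsum_sums qsum_weighted_sums) auto
  then have "(\<lambda>m. of_nat m * (z ^ m * qprod q m)) sums
      (of_nat 0 * (z ^ 0 * qprod q 0) + (z * (qsum_weighted q z + qsum q z)
        + (- (z * q\<^sup>2)) * (qsum_weighted q (z * q) + qsum q (z * q))))"
    by (rule fps_sums_from_Suc[where f = "\<lambda>m. of_nat m * (z ^ m * qprod q m)"])
  from sums_unique2[OF this qsum_weighted_sums[OF assms]] show ?thesis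
    by simp
qed

text \<open>\<open>alt_factor q z s\<close> is the multiplier $a$ at the point $zq^s$, that is,
  $-zq^s \cdot q^2/(1 - zq^s)$.\<close>

definition alt_factor :: "rat fps \<Rightarrow> rat fps \<Rightarrow> nat \<Rightarrow> rat fps" where
  "alt_factor q z s = - (z * q ^ (s + 2)) * inverse (1 - z * q ^ s)"

definition alt_term :: "rat fps \<Rightarrow> rat fps \<Rightarrow> nat \<Rightarrow> rat fps" where
  "alt_term q z i = (\<Prod>s<i. alt_factor q z s) * (\<Sum>s<i. inverse (1 - z * q ^ s))"

text \<open>With the hypothesis $c = q^2/(1-q^2)$, the affine function \<open>Q\<close> of \<open>qsum\<close> satisfies
  $Q_s = 1 + a_s Q_{s+1}$, and \<open>R\<close> satisfies $R_s = a_s (b_s Q_{s+1} + R_{s+1})$ with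
  $b_s = 1/(1-zq^s)$. Each use of the second equation splits off the next \<open>alt_term\<close>: the 1 in
  $Q$ contributes it, and $Q - 1$ is passed on to the remainder.\<close>

lemma qsum_weighted_unroll:
  assumes q: "fps_nth q 0 = 0" and z: "fps_nth z 0 = 0" and c: "c * (1 - q\<^sup>2) = q\<^sup>2"
  defines "Q \<equiv> \<lambda>s. 1 + c * (1 - qsum q (z * q ^ s))"
    and "R \<equiv> \<lambda>s. - (c * qsum_weighted q (z * q ^ s))"
  shows "R 0 = (\<Sum>i<N. alt_term q z (Suc i)) + (\<Prod>s<N. alt_factor q z s) *
      ((\<Sum>s<N. inverse (1 - z * q ^ s)) * (Q N - 1) + R N)"
proof (induction N)
  case (Suc N)
  define u where "u = z * q ^ N"
  define b where "b = inverse (1 - u)"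
  define a where "a = alt_factor q z N"
  have u0: "fps_nth u 0 = 0" using z by (simp add: u_def)
  have b: "(1 - u) * b = 1" unfolding b_def
    by (rule inverse_mult_eq_1') (simp add: u0)
  have a: "a = - (u * q\<^sup>2) * b"
    by (simp add: a_def b_def u_def alt_factor_def power_add power2_eq_square mult.assoc)
  have uq: "z * q ^ Suc N = u * q" by (simp add: u_def mult_ac)
  have divide: "X = b * Y" if "(1 - u) * X = Y" for X Y
    unfolding that[symmetric] mult.assoc[symmetric] mult.commute[of b] b by simp
  have B: "(1 - u) * qsum q u = 1 - u * q\<^sup>2 * qsum q (u * q)"
    by (rule qsum_shift[OF u0])
  have Q_eq: "Q N = 1 + c * (1 - qsum q u)" "Q (Suc N) = 1 + c * (1 - qsum q (u * q))"
    and R_eq: "R N = - (c * qsum_weighted q u)" "R (Suc N) = - (c * qsum_weighted q (u * q))"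
    by (simp_all only: Q_def R_def uq u_def[symmetric])
  have "(1 - u) * (Q N - 1) = c * (1 - u) - c * ((1 - u) * qsum q u)"
    by (simp add: Q_eq algebra_simps)
  also have "\<dots> = - (u * q\<^sup>2) * Q (Suc N) - u * (c * (1 - q\<^sup>2) - q\<^sup>2)"
    unfolding B Q_eq by (simp add: algebra_simps)
  also have "\<dots> = - (u * q\<^sup>2) * Q (Suc N)"
    unfolding c by simp
  finally have Q: "Q N - 1 = a * Q (Suc N)"
    unfolding a by (auto dest: divide simp: mult_ac)
  have "(1 - u) * R N = - c * (qsum_weighted q u - u * qsum_weighted q u)"
    by (simp add: R_eq algebra_simps)
  also have "qsum_weighted q u - u * qsum_weighted q u
      = u * qsum q u - u * q\<^sup>2 * (qsum_weighted q (u * q) + qsum q (u * q))"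
    using qsum_weighted_shift[OF u0, of q] by (simp add: algebra_simps)
  also have "\<dots> = qsum q u - 1 - u * q\<^sup>2 * qsum_weighted q (u * q)"
    using B by (simp add: algebra_simps)
  also have "- c * \<dots> = (Q N - 1) - u * q\<^sup>2 * R (Suc N)"
    by (simp add: Q_eq R_eq algebra_simps)
  finally have "R N = b * ((Q N - 1) - u * q\<^sup>2 * R (Suc N))"
    by (rule divide)
  also have "\<dots> = a * (b * Q (Suc N) + R (Suc N))"
    unfolding Q by (simp add: a algebra_simps)
  finally have R: "R N = a * (b * Q (Suc N) + R (Suc N))" .
  show ?case
    unfolding Suc.IH Q R
    by (simp add: alt_term_def a_def[symmetric] b_def[symmetric] u_def[symmetric] algebra_simps)
qed simp

text \<open>Each \<open>alt_factor\<close> is divisible by the indeterminate, so the remainders of the unrolled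
  identity tend to 0.\<close>

lemma alt_term_sums:
  assumes q: "fps_nth q 0 = 0" and z: "fps_nth z 0 = 0" and c: "c * (1 - q\<^sup>2) = q\<^sup>2"
  shows "(\<lambda>i. alt_term q z (Suc i)) sums (- (c * qsum_weighted q z))"
proof (rule fps_sums_if_remainders_dvd)
  fix N
  have "fps_X dvd alt_factor q z s" for s
    using z by (simp add: fps_X_dvd_iff alt_factor_def)
  then have "(\<Prod>s<N. fps_X :: rat fps) dvd (\<Prod>s<N. alt_factor q z s)"
    by (intro prod_dvd_prod)
  then have "fps_X ^ N dvd (\<Prod>s<N. alt_factor q z s)" by simp
  then show "fps_X ^ N dvd - (c * qsum_weighted q z) - (\<Sum>i<N. alt_term q z (Suc i))"
    using qsum_weighted_unroll[OF assms, of N] by simp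
qed

section \<open>Extending a word letter by letter\<close>

definition avoider :: "nat list \<Rightarrow> bool" where
  "avoider u \<longleftrightarrow> u \<in> catalan_words (length u) \<and> \<not> contains_vincular u (2, 2, 1)"

lemma contains_221_iff:
  "contains_vincular u (2, 2, 1) \<longleftrightarrow>
     (\<exists>i j. i < j \<and> Suc j < length u \<and> u ! i = u ! j \<and> u ! Suc j < u ! j)"
proof -
  have "order_isomorphic [a, b, c] [2, 2, 1] \<longleftrightarrow> a = b \<and> c < b" for a b c :: nat
    by (cases a b rule: linorder_cases; cases b c rule: linorder_cases)
       (simp_all add: order_isomorphic_def All_less_Suc numeral_eq_Suc)
  then show ?thesis by simp
qed

text \<open>Words are built by appending letters. The next lemmas say which letters may be appended;
  \<open>last u \<in> set (butlast u)\<close> expresses that the last letter is stale.\<close>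

lemma catalan_snoc:
  assumes "u \<noteq> []"
  shows "u @ [a] \<in> catalan_words (length (u @ [a])) \<longleftrightarrow>
    u \<in> catalan_words (length u) \<and> 1 \<le> a \<and> a \<le> last u + 1"
proof -
  obtain l where l: "length u = Suc l" using assms by (cases u) auto
  have "(\<forall>i. Suc i < Suc (Suc l) \<longrightarrow> (u @ [a]) ! Suc i \<le> (u @ [a]) ! i + 1) \<longleftrightarrow>
      (\<forall>i. Suc i < Suc l \<longrightarrow> u ! Suc i \<le> u ! i + 1) \<and> a \<le> u ! l + 1"
    using l by (auto simp: nth_append less_Suc_eq)
  then show ?thesis using assms l by (auto simp: catalan_words_def nth_append last_conv_nth)
qed

lemma contains_221_snoc:
  assumes "u \<noteq> []"
  shows "contains_vincular (u @ [a]) (2, 2, 1) \<longleftrightarrow>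
    contains_vincular u (2, 2, 1) \<or> (last u \<in> set (butlast u) \<and> a < last u)"
proof -
  obtain v b where u: "u = v @ [b]" using assms by (cases u rule: rev_cases) auto
  let ?occ = "\<lambda>w i j. i < j \<and> w ! i = w ! j \<and> w ! Suc j < (w ! j :: nat)"
  have "contains_vincular (u @ [a]) (2, 2, 1) \<longleftrightarrow>
      (\<exists>j i. Suc j < length u \<and> ?occ (u @ [a]) i j) \<or> (\<exists>i. ?occ (u @ [a]) i (length v))"
  proof -
    have "Suc j < length (u @ [a]) \<longleftrightarrow> Suc j < length u \<or> j = length v" for j
      by (auto simp: u)
    then show ?thesis unfolding contains_221_iff by blast
  qed
  also have "(\<exists>j i. Suc j < length u \<and> ?occ (u @ [a]) i j) \<longleftrightarrow> (\<exists>j i. Suc j < length u \<and> ?occ u i j)"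
    by (intro ex_cong1 conj_cong refl) (simp_all add: nth_append)
  also have "\<dots> \<longleftrightarrow> contains_vincular u (2, 2, 1)"
    unfolding contains_221_iff by blast
  also have "(\<exists>i. ?occ (u @ [a]) i (length v)) \<longleftrightarrow> (\<exists>i<length v. v ! i = b) \<and> a < b"
    by (auto simp: u nth_append)
  also have "(\<exists>i<length v. v ! i = b) \<longleftrightarrow> b \<in> set v"
    by (simp add: in_set_conv_nth)
  finally show ?thesis by (simp add: u)
qed

lemma avoider_snoc:
  assumes "u \<noteq> []"
  shows "avoider (u @ [a]) \<longleftrightarrow> avoider u \<and> 1 \<le> a \<and> a \<le> last u + 1 \<and>
    (last u \<in> set (butlast u) \<longrightarrow> last u \<le> a)"
  unfolding avoider_def catalan_snoc[OF assms] contains_221_snoc[OF assms] by auto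

lemma avoider_prefix:
  assumes "u \<noteq> []" and "avoider (u @ w)"
  shows "avoider u"
  using assms(2)
proof (induction w rule: rev_induct)
  case (snoc a w)
  then show ?case using avoider_snoc[of "u @ w" a] assms(1) by simp
qed simp

definition extensions :: "nat list \<Rightarrow> nat \<Rightarrow> nat list set" where
  "extensions u n = {w. length w = n \<and> avoider (u @ w)}"

lemma extensions_0: "avoider u \<Longrightarrow> extensions u 0 = {[]}"
  by (auto simp: extensions_def)

lemma extensions_Suc:
  assumes "u \<noteq> []"
  shows "extensions u (Suc n) =
    (\<Union>a\<in>{a. avoider (u @ [a])}. (#) a ` extensions (u @ [a]) n)"
proof -
  have "avoider (u @ [a])" if "avoider (u @ a # w)" for a w
    using avoider_prefix[of "u @ [a]" w] that by simp
  then show ?thesis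
    by (fastforce simp: extensions_def length_Suc_conv)
qed

lemma finite_avoider_snoc: "u \<noteq> [] \<Longrightarrow> finite {a. avoider (u @ [a])}"
  by (rule finite_subset[of _ "{..last u + 1}"]) (auto simp: avoider_snoc)

lemma finite_extensions: "u \<noteq> [] \<Longrightarrow> finite (extensions u n)"
proof (induction n arbitrary: u)
  case 0
  show ?case by (rule finite_subset[of _ "{[]}"]) (auto simp: extensions_def)
next
  case (Suc n)
  then show ?case by (auto simp: extensions_Suc finite_avoider_snoc)
qed

lemma card_extensions_Suc:
  assumes "u \<noteq> []"
  shows "card (extensions u (Suc n)) = (\<Sum>a | avoider (u @ [a]). card (extensions (u @ [a]) n))"
proof -
  have "card (extensions u (Suc n))
      = (\<Sum>a | avoider (u @ [a]). card ((#) a ` extensions (u @ [a]) n))"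
    unfolding extensions_Suc[OF assms]
    by (rule card_UN_disjoint) (auto simp: finite_avoider_snoc finite_extensions assms)
  then show ?thesis by (simp add: card_image)
qed

text \<open>The numbers of extensions by \<open>n\<close> letters of a word with letters \<open>1, \<dots>, m\<close>: its last letter
  is fresh (and so equal to \<open>m\<close>) for \<open>fresh_count\<close>, and it is stale and equal to \<open>l\<close> for
  \<open>stale_count\<close>.\<close>

fun fresh_count :: "nat \<Rightarrow> nat \<Rightarrow> nat" and stale_count :: "nat \<Rightarrow> nat \<Rightarrow> nat \<Rightarrow> nat" where
  "fresh_count m 0 = 1"
| "fresh_count m (Suc n) = fresh_count (Suc m) n + (\<Sum>a=1..m. stale_count m a n)"
| "stale_count m l 0 = 1"
| "stale_count m l (Suc n) = stale_count m l n +
     (if l = m then fresh_count (Suc m) n else stale_count m (Suc l) n)"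

text \<open>All letters up to \<open>m\<close> have occurred, so an appended letter is fresh iff it is \<open>m + 1\<close>. This
  is possible after the letter \<open>m\<close>, whether it is fresh or stale, and after no smaller one.\<close>

lemma card_extensions:
  shows "\<lbrakk>u \<noteq> []; avoider u; set u = {1..m}; last u = m; m \<notin> set (butlast u)\<rbrakk>
      \<Longrightarrow> card (extensions u n) = fresh_count m n"
    and "\<lbrakk>u \<noteq> []; avoider u; set u = {1..m}; last u \<in> set (butlast u)\<rbrakk>
      \<Longrightarrow> card (extensions u n) = stale_count m (last u) n"
proof (induction n arbitrary: u m)
  case 0
  {
    case 1 then show ?case by (simp add: extensions_0)
  next
    case 2 then show ?case by (simp add: extensions_0)
  }
next
  case (Suc n)
  have new: "card (extensions (u @ [Suc m]) n) = fresh_count (Suc m) n"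
    if "avoider (u @ [Suc m])" "set u = {1..m}" for u :: "nat list" and m
  proof (rule Suc.IH(1))
    show "set (u @ [Suc m]) = {1..Suc m}"
      using that(2) by (simp add: atLeastAtMostSuc_conv)
  qed (use that in simp_all)
  have old: "card (extensions (u @ [a]) n) = stale_count m a n"
    if "avoider (u @ [a])" "set u = {1..m}" "a \<in> {1..m}" for u :: "nat list" and m a
  proof -
    have "card (extensions (u @ [a]) n) = stale_count m (last (u @ [a])) n"
    proof (rule Suc.IH(2))
      show "set (u @ [a]) = {1..m}"
        using that(2,3) by (simp add: insert_absorb)
    qed (use that in simp_all)
    then show ?thesis by simp
  qed
  {
    case 1
    have step: "avoider (u @ [a]) \<longleftrightarrow> a \<in> insert (Suc m) {1..m}" for a
      unfolding avoider_snoc[OF 1(1)] using 1 by auto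
    have "card (extensions u (Suc n)) = (\<Sum>a\<in>insert (Suc m) {1..m}. card (extensions (u @ [a]) n))"
      unfolding card_extensions_Suc[OF 1(1)] step Collect_mem_eq ..
    also have "\<dots> = card (extensions (u @ [Suc m]) n) + (\<Sum>a=1..m. card (extensions (u @ [a]) n))"
      by simp
    also have "\<dots> = fresh_count (Suc m) n + (\<Sum>a=1..m. stale_count m a n)"
      by (intro arg_cong2[where f = "(+)"] sum.cong refl new old) (use 1(3) step in auto)
    finally show ?case by simp
  next
    case 2
    have "last u \<in> set u" using 2(1) by simp
    then have l: "last u \<in> {1..m}" using 2(3) by simp
    have step: "avoider (u @ [a]) \<longleftrightarrow> a \<in> {last u, Suc (last u)}" for a
      unfolding avoider_snoc[OF 2(1)] using 2(2,4) l by auto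
    have "card (extensions u (Suc n))
        = card (extensions (u @ [last u]) n) + card (extensions (u @ [Suc (last u)]) n)"
      unfolding card_extensions_Suc[OF 2(1)] step Collect_mem_eq by simp
    also have "card (extensions (u @ [last u]) n) = stale_count m (last u) n"
      by (rule old) (use 2(3) step l in auto)
    also have "card (extensions (u @ [Suc (last u)]) n)
        = (if last u = m then fresh_count (Suc m) n else stale_count m (Suc (last u)) n)"
    proof (cases "last u = m")
      case True
      then show ?thesis using new[of u m] 2(3) step by simp
    next
      case False
      then have "Suc (last u) \<in> {1..m}" using l by simp
      then show ?thesis using False old[of u "Suc (last u)" m] 2(3) step by simp
    qed
    finally show ?case by simp
  }
qed

lemma avoid_count_eq: "catalan_avoid_count (2, 2, 1) (Suc n) = fresh_count 1 n"
proof -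
  have "w \<in> {w \<in> catalan_words (Suc n). \<not> contains_vincular w (2, 2, 1)} \<longleftrightarrow>
      w \<in> (#) 1 ` extensions [1] n" for w
    by (cases w) (auto simp: extensions_def avoider_def catalan_words_def)
  then have "{w \<in> catalan_words (Suc n). \<not> contains_vincular w (2, 2, 1)} = (#) 1 ` extensions [1] n"
    by blast
  then have "catalan_avoid_count (2, 2, 1) (Suc n) = card (extensions [1] n)"
    by (simp add: catalan_avoid_count_def card_image)
  also have "avoider [1]"
    by (auto simp: avoider_def catalan_words_def contains_221_iff)
  then have "card (extensions [1] n) = fresh_count 1 n"
    by (intro card_extensions(1)) auto
  finally show ?thesis .
qed

section \<open>The generating function of the extensions\<close>

abbreviation T :: "rat fps" where "T \<equiv> fps_X"

definition gf_fresh :: "nat \<Rightarrow> rat fps" where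
  "gf_fresh m = Abs_fps (\<lambda>n. of_nat (fresh_count m n))"

definition gf_stale :: "nat \<Rightarrow> nat \<Rightarrow> rat fps" where
  "gf_stale m l = Abs_fps (\<lambda>n. of_nat (stale_count m l n))"

lemma gf_fresh_rec: "gf_fresh m = 1 + T * (gf_fresh (Suc m) + (\<Sum>a=1..m. gf_stale m a))"
proof (rule fps_ext)
  fix n
  show "fps_nth (gf_fresh m) n
      = fps_nth (1 + T * (gf_fresh (Suc m) + (\<Sum>a=1..m. gf_stale m a))) n"
    by (cases n) (simp_all add: gf_fresh_def gf_stale_def fps_sum_nth)
qed

lemma gf_stale_rec:
  "gf_stale m l = 1 + T * (gf_stale m l + (if l = m then gf_fresh (Suc m) else gf_stale m (Suc l)))"
proof (rule fps_ext)
  fix n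
  show "fps_nth (gf_stale m l) n = fps_nth (1 + T * (gf_stale m l +
      (if l = m then gf_fresh (Suc m) else gf_stale m (Suc l)))) n"
    by (cases n) (simp_all add: gf_fresh_def gf_stale_def)
qed

text \<open>A stale run stays $k \ge 1$ times on a letter before it climbs to the next one, which
  contributes $t + t^2 + \dots = t/(1-t)$, the series \<open>qT\<close>. The series \<open>xT\<close> is determined by
  $x(1-q) = t$. The series \<open>doubling\<close> has coefficients $2^n$.\<close>

definition qT :: "rat fps" where "qT = T * inverse (1 - T)"
definition xT :: "rat fps" where "xT = T * (1 - T) * inverse (1 - 2 * T)"
definition doubling :: "rat fps" where "doubling = inverse (1 - 2 * T)"

lemma inverse_one_minus_T: "(1 - T) * inverse (1 - T) = 1"
  by (rule inverse_mult_eq_1') simp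

lemma doubling_eq: "(1 - 2 * T) * doubling = 1"
  unfolding doubling_def by (rule inverse_mult_eq_1') simp

lemma qT_eq: "(1 - T) * qT = T"
  unfolding qT_def using inverse_one_minus_T by algebra

lemma xT_eq: "xT = T * (1 - T) * doubling"
  by (simp add: xT_def doubling_def)

lemma xT_one_minus_qT: "xT * (1 - qT) = T"
proof -
  have "xT * (1 - qT) = T * doubling * ((1 - T) - (1 - T) * qT)"
    by (simp add: xT_eq algebra_simps)
  also have "\<dots> = T * ((1 - 2 * T) * doubling)"
    unfolding qT_eq by (simp add: algebra_simps)
  finally show ?thesis by (simp add: doubling_eq)
qed

lemma xT_mult_qT: "xT * qT = T\<^sup>2 * doubling"
proof -
  have "xT * qT = T * doubling * ((1 - T) * qT)"
    by (simp add: xT_eq mult_ac)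
  then show ?thesis unfolding qT_eq by (simp add: power2_eq_square mult_ac)
qed

text \<open>The constant solution \<open>doubling\<close> of the stale equations is subtracted. Their homogeneous
  part multiplies by \<open>qT\<close> with each letter between the last one and the maximum.\<close>

lemma gf_stale_eq:
  "k < m \<Longrightarrow> gf_stale m (m - k) - doubling = qT ^ Suc k * (gf_fresh (Suc m) - doubling)"
proof (induction k)
  case 0
  have "(1 - T) * (gf_stale m m - doubling) = (1 - T) * (qT * (gf_fresh (Suc m) - doubling))"
    using gf_stale_rec[of m m] qT_eq doubling_eq by simp algebra
  \<comment> \<open>Cancel the factor $1 - t$, which is nonzero because its constant coefficient is 1.\<close>
  then show ?case by (auto dest: arg_cong[where f = "\<lambda>f. fps_nth f 0"])
next
  case (Suc k)
  have S: "Suc (m - Suc k) = m - k" "m - Suc k \<noteq> m" using Suc.prems by auto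
  have "gf_stale m (m - Suc k) = 1 + T * (gf_stale m (m - Suc k) + gf_stale m (m - k))"
    using gf_stale_rec[of m "m - Suc k"] S by simp
  then have "(1 - T) * (gf_stale m (m - Suc k) - doubling)
      = (1 - T) * (qT * (gf_stale m (m - k) - doubling))"
    using qT_eq doubling_eq by algebra
  then have "gf_stale m (m - Suc k) - doubling = qT * (gf_stale m (m - k) - doubling)"
    by (auto dest: arg_cong[where f = "\<lambda>f. fps_nth f 0"])
  then show ?case using Suc by simp
qed

text \<open>The successors of a fresh word are $m + 1$ and the $m$ stale letters. By \<open>gf_stale_eq\<close> the
  homogeneous parts add up to $t(1 + q + \dots + q^m) = x(1 - q^{m+1})$.\<close>

lemma gf_fresh_shift:
  assumes "m \<ge> 1"
  shows "gf_fresh m - doubling =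
    T * doubling * of_nat (m - 1) + xT * (1 - qT ^ Suc m) * (gf_fresh (Suc m) - doubling)"
proof -
  define d where "d = gf_fresh (Suc m) - doubling"
  define G where "G = (\<Sum>k<Suc m. qT ^ k)"
  have G: "(1 - qT) * G = 1 - qT ^ Suc m"
    unfolding G_def by (rule one_diff_power_eq[symmetric])
  have "(\<Sum>a=1..m. gf_stale m a) = (\<Sum>k<m. gf_stale m (m - k))"
    by (rule sum.reindex_bij_witness[of _ "\<lambda>k. m - k" "\<lambda>a. m - a"]) auto
  also have "\<dots> = (\<Sum>k<m. doubling + qT ^ Suc k * d)"
    by (intro sum.cong) (auto simp: gf_stale_eq d_def algebra_simps dest!: gf_stale_eq)
  also have "\<dots> = of_nat m * doubling + (G - 1) * d"
    by (simp add: G_def sum.distrib sum.lessThan_Suc_shift sum_distrib_right del: sum.lessThan_Suc)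
  finally have "gf_fresh m = 1 + T * ((d + doubling) + (of_nat m * doubling + (G - 1) * d))"
    using gf_fresh_rec[of m] by (simp add: d_def)
  moreover have "(of_nat m :: rat fps) = of_nat (m - 1) + 1"
    using assms by (cases m) auto
  ultimately have "gf_fresh m - doubling
      = T * doubling * of_nat (m - 1) + T * G * d + (1 - (1 - 2 * T) * doubling)"
    by (simp only:) (simp add: algebra_simps)
  moreover have "xT * (1 - qT ^ Suc m) = T * G"
    unfolding G[symmetric] mult.assoc[symmetric] xT_one_minus_qT ..
  ultimately show ?thesis
    unfolding d_def[symmetric] by (simp only: doubling_eq) simp
qed

text \<open>Iterating \<open>gf_fresh_shift\<close> multiplies the factors $x(1-q^{m+1})$ to
  $x^m (q^2;q)_m$, and these tend to 0 since $x$ is divisible by $t$.\<close>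

lemma gf_fresh_1: "gf_fresh 1 - doubling = T * doubling * qsum_weighted qT xT"
proof -
  have x0: "fps_nth xT 0 = 0" by (simp add: xT_def)
  have unroll: "gf_fresh 1 - doubling = (\<Sum>m<N. T * doubling * (of_nat m * (xT ^ m * qprod qT m)))
      + xT ^ N * qprod qT N * (gf_fresh (Suc N) - doubling)" for N
  proof (induction N)
    case (Suc N)
    show ?case
      unfolding Suc.IH gf_fresh_shift[of "Suc N", simplified]
      by (simp add: qprod_def algebra_simps)
  qed (simp add: qprod_def)
  have "(\<lambda>m. T * doubling * (of_nat m * (xT ^ m * qprod qT m))) sums (gf_fresh 1 - doubling)"
  proof (rule fps_sums_if_remainders_dvd)
    fix N
    have "T ^ N dvd xT ^ N" using x0 by (intro dvd_power_same) (simp add: fps_X_dvd_iff)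
    then show "T ^ N dvd gf_fresh 1 - doubling
        - (\<Sum>m<N. T * doubling * (of_nat m * (xT ^ m * qprod qT m)))"
      unfolding unroll[of N] by simp
  qed
  from sums_unique2[OF this fps_sums_mult[OF qsum_weighted_sums[OF x0]]] show ?thesis .
qed

section \<open>The summands of the alternating series\<close>

text \<open>In terms of $q$ and $x$ the denominators are $q$-shifts of $1 - x$ up to simple factors, because
  $(1-t)^2 q = (1-2t)x$.\<close>

lemma gf_denom_Suc: "gf_denom (Suc s) = (1 - T) ^ Suc s * (1 - 2 * T) * (1 - xT * qT ^ s)"
proof -
  have "(1 - T) ^ s * qT ^ s = T ^ s"
    by (simp add: power_mult_distrib[symmetric] qT_eq)
  then have "gf_denom (Suc s) = (1 - T) ^ Suc s * (1 - 2 * T)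
      - (1 - T)\<^sup>2 * T * ((1 - 2 * T) * doubling) * ((1 - T) ^ s * qT ^ s)"
    unfolding gf_denom_def doubling_eq by (simp add: mult_ac)
  also have "\<dots> = (1 - T) ^ Suc s * (1 - 2 * T) - (1 - T) ^ Suc s * (1 - 2 * T) * (xT * qT ^ s)"
    by (simp only: xT_eq power2_eq_square power_Suc mult_ac)
  finally show ?thesis by (simp only: right_diff_distrib mult_1_right)
qed

lemma gf_denom_0: "fps_nth (gf_denom (Suc s)) 0 = 1"
  by (simp add: gf_denom_Suc xT_def fps_nth_power_0)

text \<open>Distributing $t^{i(i+5)/2} = \prod_{s<i} t^{s+3}$ over the $i$ denominators turns each quotient
  into one \<open>alt_factor\<close>, since $xq = t^2/(1-2t)$. The remaining $1-2t$ cancels against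
  the factor that \<open>gf_denom_Suc\<close> splits off in the inner sum.\<close>

lemma gf_summand_eq: "gf_summand i = alt_term qT xT i"
proof -
  define I where "I = inverse (1 - T)"
  have inv_pow: "inverse ((1 - T) ^ n) = I ^ n" for n
    by (induction n) (simp_all add: I_def fps_inverse_mult)
  have inv: "inverse (gf_denom (Suc s)) = I ^ Suc s * doubling * inverse (1 - xT * qT ^ s)" for s
    unfolding gf_denom_Suc fps_inverse_mult inv_pow doubling_def ..
  have summ: "(1 - T) ^ Suc s / gf_denom (Suc s) = doubling * inverse (1 - xT * qT ^ s)" for s
  proof -
    have "(1 - T) ^ Suc s * I ^ Suc s = 1"
      unfolding power_mult_distrib[symmetric] I_def inverse_one_minus_T by simp
    then show ?thesis
      using gf_denom_0[of s]
      by (simp add: fps_divide_unit inv mult.assoc[symmetric] del: power_Suc)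
  qed
  have factor: "- (T ^ (s + 3)) * inverse (gf_denom (Suc s)) = alt_factor qT xT s" for s
  proof -
    have "T ^ (s + 3) * (I ^ Suc s * doubling) = (T\<^sup>2 * doubling) * (T * I) ^ Suc s"
      by (simp add: power_mult_distrib power_add numeral_eq_Suc mult_ac)
    also have "\<dots> = xT * qT ^ (s + 2)"
      unfolding xT_mult_qT[symmetric] by (simp add: qT_def I_def mult_ac)
    finally have "T ^ (s + 3) * (I ^ Suc s * doubling) = xT * qT ^ (s + 2)" .
    then show ?thesis by (simp add: inv alt_factor_def mult.assoc[symmetric])
  qed
  have exponent: "(Suc i * (Suc i + 5)) div 2 = i * (i + 5) div 2 + (i + 3)" for i :: nat
  proof -
    have "Suc i * (Suc i + 5) = i * (i + 5) + 2 * (i + 3)" by (simp add: algebra_simps)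
    then show ?thesis by (simp only: div_mult_self4) simp
  qed
  have prod: "(-1) ^ i * T ^ (i * (i + 5) div 2) * inverse (\<Prod>s<i. gf_denom (Suc s))
      = (\<Prod>s<i. alt_factor qT xT s)" for i
  proof (induction i)
    case (Suc i)
    have "(-1) ^ Suc i * T ^ (Suc i * (Suc i + 5) div 2) * inverse (\<Prod>s<Suc i. gf_denom (Suc s))
        = ((-1) ^ i * T ^ (i * (i + 5) div 2) * inverse (\<Prod>s<i. gf_denom (Suc s)))
          * (- (T ^ (i + 3)) * inverse (gf_denom (Suc i)))"
      unfolding prod.lessThan_Suc fps_inverse_mult exponent by (simp add: power_add mult_ac)
    then show ?case
      unfolding Suc.IH factor by simp
  qed simp
  have shift: "{1..i} = Suc ` {..<i}"
    by (auto simp: image_iff Bex_def) (metis Suc_le_D Suc_le_eq)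
  have prods: "(\<Prod>j=1..i. gf_denom j) = (\<Prod>s<i. gf_denom (Suc s))"
    unfolding shift by (simp add: prod.reindex)
  have sums: "(\<Sum>j=1..i. (1 - T) ^ j / gf_denom j)
      = doubling * (\<Sum>s<i. inverse (1 - xT * qT ^ s))"
    unfolding shift by (simp add: sum.reindex summ sum_distrib_left del: power_Suc)
  have "fps_nth (\<Prod>s<i. gf_denom (Suc s)) 0 = 1"
    by (induction i) (simp_all add: gf_denom_0)
  then have nonzero: "fps_nth (\<Prod>s<i. gf_denom (Suc s)) 0 \<noteq> 0" by simp
  have "gf_summand i = (-1) ^ i * T ^ (i * (i + 5) div 2) * (1 - 2 * T) *
      (doubling * (\<Sum>s<i. inverse (1 - xT * qT ^ s))) * inverse (\<Prod>s<i. gf_denom (Suc s))"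
    unfolding gf_summand_def prods sums by (rule fps_divide_unit[OF nonzero])
  also have "\<dots> = ((1 - 2 * T) * doubling) *
      ((-1) ^ i * T ^ (i * (i + 5) div 2) * inverse (\<Prod>s<i. gf_denom (Suc s))) *
      (\<Sum>s<i. inverse (1 - xT * qT ^ s))"
    by (simp only: mult_ac)
  also have "\<dots> = alt_term qT xT i"
    unfolding doubling_eq prod alt_term_def by simp
  finally show ?thesis .
qed

theorem theorem2p3:
  shows "summable (\<lambda>i. gf_summand (Suc i)) \<and>
    Abs_fps (\<lambda>n. if n \<ge> 1 then of_nat (catalan_avoid_count (2, 2, 1) n) else 0) =
      fps_X / (1 - 2 * fps_X) - (\<Sum>i. gf_summand (Suc i))"
proof
  have c: "T\<^sup>2 * doubling * (1 - qT\<^sup>2) = qT\<^sup>2"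
  proof -
    have "T\<^sup>2 * doubling * (1 - qT\<^sup>2) = (xT * (1 - qT)) * qT * (1 + qT)"
      unfolding xT_mult_qT[symmetric] by (simp add: power2_eq_square algebra_simps)
    also have "\<dots> = qT * (T + T * qT)"
      unfolding xT_one_minus_qT by (simp add: algebra_simps)
    also have "T + T * qT = qT"
      using qT_eq by (simp add: algebra_simps)
    finally show ?thesis by (simp add: power2_eq_square)
  qed
  have sums: "(\<lambda>i. gf_summand (Suc i)) sums (- (T\<^sup>2 * doubling * qsum_weighted qT xT))"
    unfolding gf_summand_eq by (rule alt_term_sums[OF _ _ c]) (simp_all add: qT_def xT_def)
  then show "summable (\<lambda>i. gf_summand (Suc i))" by (rule sums_summable)
  have "Abs_fps (\<lambda>n. if n \<ge> 1 then of_nat (catalan_avoid_count (2, 2, 1) n) else 0)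
      = T * gf_fresh 1"
  proof (rule fps_ext)
    fix n
    show "fps_nth (Abs_fps (\<lambda>n. if n \<ge> 1 then of_nat (catalan_avoid_count (2, 2, 1) n) else 0)) n
        = fps_nth (T * gf_fresh 1) n"
      by (cases n) (simp_all add: avoid_count_eq gf_fresh_def del: One_nat_def)
  qed
  also have "\<dots> = T * doubling + T\<^sup>2 * doubling * qsum_weighted qT xT"
    using gf_fresh_1 by algebra
  also have "T * doubling = T / (1 - 2 * T)"
    by (simp add: doubling_def fps_divide_unit)
  finally show "Abs_fps (\<lambda>n. if n \<ge> 1 then of_nat (catalan_avoid_count (2, 2, 1) n) else 0) =
      fps_X / (1 - 2 * fps_X) - (\<Sum>i. gf_summand (Suc i))"
    unfolding sums_unique[OF sums, symmetric] by simp
qed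

end
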